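(* Let $\{\mathcal{G}_n\}_{n\ge 2}$ be the sequence of $n$-agent mean-field games with action interval $[a,b]$, utility family $u$ and deterministic parameters $(\alpha_i)_{i\ge 1}$ described in the context, whose best response function $\mathrm{Br}$ is Lipschitz in $z$ with constant $L_z<1$ and Lipschitz in $\alpha$ with constant $L$, and such that the empirical distributions $P_n$ of $\{\alpha_i\}_{i=1}^n$ converge pointwise to a continuous distribution function $P$. Let $z^\star_{i,n}$ denote the equilibrium mean variable of agent $i$ at the Nash equilibrium of $\mathcal{G}_n$, and let $z^\star_{\rm AEM}$ be the asymptotic equilibrium mean. Then $$\lim_{n\to\infty}\ \sup_{1\le i\le n}\left|z^\star_{i,n}-z^\star_{\rm AEM}\right|=0 .$$
   Context: Game. Let $a\le b$ be reals, $u:[a,b]\times\mathbb{R}\times\mathbb{R}\to\mathbb{R}$ a function, and $(\alpha_i)_{i\ge1}$ a deterministic sequence of reals. For $n\ge 2$, $\mathcal{G}_n$ is the non-cooperative game with agents $1,\dots,n$ in which agent $i$ chooses an action $x_i\in[a,b]$ and maximizes the utility $u(x_i,z_{i,n},\alpha_i)$, where $z_{i,n}=\frac{1}{n-1}\sum_{j\ne i}x_j$ is the mean variable of agent $i$. Best response. $\mathrm{Br}(z,\alpha)=\arg\max_{a\le x\le b}u(x,z,\alpha)$; for all $z,\alpha\in\mathbb{R}$ the maximizer is assumed to exist and be unique, so $\mathrm{Br}:\mathbb{R}\times\mathbb{R}\to[a,b]$ is a function. Assumptions. (1) There is a constant $0<L_z<1$ with $|\mathrm{Br}(z,\alpha)-\mathrm{Br}(z',\alpha)|\le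 L_z|z-z'|$ for all $z,z',\alpha\in\mathbb{R}$. (2) There is a constant $L>0$ with $|\mathrm{Br}(z,\alpha)-\mathrm{Br}(z,\alpha')|\le L|\alpha-\alpha'|$ for all $z,\alpha,\alpha'\in\mathbb{R}$. (3) With $P_n(\alpha)=\frac1n\sum_{i=1}^n \mathbf{1}\{\alpha_i\le\alpha\}$, there is a continuous (probability) distribution function $P$ such that $\lim_{n\to\infty}P_n(\alpha)=P(\alpha)$ for all $\alpha\in\mathbb{R}$. Nash equilibrium. A Nash equilibrium of $\mathcal{G}_n$ is $(x^\star_{1,n},\dots,x^\star_{n,n})\in[a,b]^n$ with $x^\star_{i,n}=\mathrm{Br}(z^\star_{i,n},\alpha_i)$ for all $i$, where $z^\star_{i,n}=\frac{1}{n-1}\sum_{j\ne i}x^\star_{j,n}$. Under the assumptions it exists and is unique. Asymptotic equilibrium mean. $z^\star_{\rm AEM}$ is the (unique) solution $z$ of $z=\int_{-\infty}^{\infty}\mathrm{Br}(z,\alpha)\,dP(\alpha)$. *)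

theory Defs
  imports "HOL-Probability.Probability"
begin

text \<open>
  Agents are indexed by \<open>{1..n}\<close>. The utility is a total function on the reals, but only its
  values at actions in \<open>{a..b}\<close> are ever used.
\<close>

definition Br :: "real \<Rightarrow> real \<Rightarrow> (real \<Rightarrow> real \<Rightarrow> real \<Rightarrow> real) \<Rightarrow> real \<Rightarrow> real \<Rightarrow> real" where
  "Br a b u z t = arg_max_on (\<lambda>x. u x z t) {a..b}"

definition mean_var :: "nat \<Rightarrow> (nat \<Rightarrow> real) \<Rightarrow> nat \<Rightarrow> real" where
  "mean_var n x i = (\<Sum>j\<in>{1..n} - {i}. x j) / (real n - 1)"

text \<open>
  Action profiles are extensional functions on \<open>{1..n}\<close>, so that uniqueness of an equilibrium is
  equality of functions.
\<close>

definition is_nash ::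
  "real \<Rightarrow> real \<Rightarrow> (real \<Rightarrow> real \<Rightarrow> real \<Rightarrow> real) \<Rightarrow> (nat \<Rightarrow> real) \<Rightarrow> nat \<Rightarrow> (nat \<Rightarrow> real) \<Rightarrow> bool" where
  "is_nash a b u \<alpha> n x \<longleftrightarrow>
     x \<in> {1..n} \<rightarrow>\<^sub>E {a..b} \<and> (\<forall>i\<in>{1..n}. x i = Br a b u (mean_var n x i) (\<alpha> i))"

definition nash ::
  "real \<Rightarrow> real \<Rightarrow> (real \<Rightarrow> real \<Rightarrow> real \<Rightarrow> real) \<Rightarrow> (nat \<Rightarrow> real) \<Rightarrow> nat \<Rightarrow> nat \<Rightarrow> real" where
  "nash a b u \<alpha> n = (THE x. is_nash a b u \<alpha> n x)"

definition emp_cdf :: "(nat \<Rightarrow> real) \<Rightarrow> nat \<Rightarrow> real \<Rightarrow> real" where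
  "emp_cdf \<alpha> n t = (\<Sum>i=1..n. of_bool (\<alpha> i \<le> t)) / real n"

text \<open>
  The integral with respect to \<open>dP\<close> is the Lebesgue--Stieltjes integral, i.e. the integral with
  respect to \<open>interval_measure P\<close>.
\<close>

definition is_aem ::
  "real \<Rightarrow> real \<Rightarrow> (real \<Rightarrow> real \<Rightarrow> real \<Rightarrow> real) \<Rightarrow> (real \<Rightarrow> real) \<Rightarrow> real \<Rightarrow> bool" where
  "is_aem a b u P z \<longleftrightarrow> z = (LINT t|interval_measure P. Br a b u z t)"

definition aem ::
  "real \<Rightarrow> real \<Rightarrow> (real \<Rightarrow> real \<Rightarrow> real \<Rightarrow> real) \<Rightarrow> (real \<Rightarrow> real) \<Rightarrow> real" where
  "aem a b u P = (THE z. is_aem a b u P z)"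

text \<open>
  The descriptions \<^const>\<open>nash\<close> and \<^const>\<open>aem\<close> are well defined under the standing assumptions.
\<close>

lemma Br_in_interval:
  assumes "\<And>z t. \<exists>!x. is_arg_max (\<lambda>x. u x z t) (\<lambda>x. x \<in> {a..b}) x"
  shows "Br a b u z t \<in> {a..b}"
proof -
  have "is_arg_max (\<lambda>x. u x z t) (\<lambda>x. x \<in> {a..b}) (Br a b u z t)"
    unfolding Br_def arg_max_on_def arg_max_def using assms[of z t] by (metis someI_ex)
  then show ?thesis by (simp add: is_arg_max_def)
qed

lemma mean_var_dist:
  assumes "n \<ge> 2" "i \<in> {1..n}" "\<And>j. j \<in> {1..n} \<Longrightarrow> \<bar>x j - y j\<bar> \<le> d"
  shows "\<bar>mean_var n x i - mean_var n y i\<bar> \<le> d"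
proof -
  have "\<bar>\<Sum>j\<in>{1..n} - {i}. x j - y j\<bar> \<le> (\<Sum>j\<in>{1..n} - {i}. \<bar>x j - y j\<bar>)"
    by (rule sum_abs)
  also have "\<dots> \<le> (\<Sum>j\<in>{1..n} - {i}. d)"
    using assms(3) by (intro sum_mono) auto
  also have "\<dots> = (real n - 1) * d"
    using assms(1,2) by (simp add: of_nat_diff)
  finally have "\<bar>\<Sum>j\<in>{1..n} - {i}. x j - y j\<bar> \<le> (real n - 1) * d" .
  moreover have "mean_var n x i - mean_var n y i = (\<Sum>j\<in>{1..n} - {i}. x j - y j) / (real n - 1)"
    by (simp add: mean_var_def sum_subtractf diff_divide_distrib)
  ultimately show ?thesis
    using assms(1) by (simp add: abs_divide divide_le_eq mult.commute)
qed

lemma nash_ex1: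
  assumes am: "\<And>z t. \<exists>!x. is_arg_max (\<lambda>x. u x z t) (\<lambda>x. x \<in> {a..b}) x"
    and "0 < Lz" "Lz < 1"
    and lip: "\<And>z z' t. \<bar>Br a b u z t - Br a b u z' t\<bar> \<le> Lz * \<bar>z - z'\<bar>"
    and n: "n \<ge> 2"
  shows "\<exists>!x. is_nash a b u \<alpha> n x"
proof -
  have Br_in: "Br a b u z t \<in> {a..b}" for z t
    using am by (rule Br_in_interval)
  define T where "T x i = (if i \<in> {1..n} then Br a b u (mean_var n x i) (\<alpha> i) else 0)" for x i
  have T_bd: "\<bar>T x i\<bar> \<le> \<bar>a\<bar> + \<bar>b\<bar>" for x i
    using Br_in[of "mean_var n x i" "\<alpha> i"] by (auto simp: T_def)
  have T_lip: "\<bar>T x i - T y i\<bar> \<le> Lz * d"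
    if "\<And>j. j \<in> {1..n} \<Longrightarrow> \<bar>x j - y j\<bar> \<le> d" "d \<ge> 0" for x y d i
  proof (cases "i \<in> {1..n}")
    case True
    have "\<bar>T x i - T y i\<bar> \<le> Lz * \<bar>mean_var n x i - mean_var n y i\<bar>"
      using True lip by (simp add: T_def)
    also have "\<dots> \<le> Lz * d"
      using mean_var_dist[OF n True that(1)] assms(2) by (intro mult_left_mono) auto
    finally show ?thesis .
  qed (use that assms(2) in \<open>auto simp: T_def\<close>)
  define X where "X k = (T ^^ k) (\<lambda>_. 0)" for k
  define C where "C = \<bar>a\<bar> + \<bar>b\<bar>"
  have X_Suc: "X (Suc k) = T (X k)" for k by (simp add: X_def)
  have X0: "X 0 i = 0" for i by (simp add: X_def)
  have step: "\<bar>X (Suc k) i - X k i\<bar> \<le> Lz ^ k * C" for k i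
  proof (induction k arbitrary: i)
    case 0
    then show ?case using T_bd by (simp add: X_def C_def)
  next
    case (Suc k)
    have "\<bar>T (X (Suc k)) i - T (X k) i\<bar> \<le> Lz * (Lz ^ k * C)"
      by (rule T_lip) (use Suc assms(2) in \<open>auto simp: C_def\<close>)
    then show ?case by (simp add: X_Suc mult.assoc)
  qed
  have "convergent (\<lambda>k. X k i)" for i
  proof -
    have "summable (\<lambda>k. X (Suc k) i - X k i)"
    proof (rule summable_comparison_test')
      show "summable (\<lambda>k. Lz ^ k * C)"
        using assms(2,3) by (intro summable_mult2 summable_geometric) auto
      show "norm (X (Suc k) i - X k i) \<le> Lz ^ k * C" if "k \<ge> 0" for k
        using step by simp
    qed
    then have "(\<lambda>m. \<Sum>k<m. X (Suc k) i - X k i) \<longlonglongrightarrow> (\<Sum>k. X (Suc k) i - X k i)"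
      by (rule summable_LIMSEQ)
    then have "(\<lambda>m. X m i) \<longlonglongrightarrow> (\<Sum>k. X (Suc k) i - X k i)"
      using X0[of i] by (simp add: sum_lessThan_telescope[of "\<lambda>k. X k i"])
    then show ?thesis by (rule convergentI)
  qed
  then obtain f where f: "\<And>i. (\<lambda>k. X k i) \<longlonglongrightarrow> f i"
    unfolding convergent_def by metis
  have mv: "mean_var n (restrict x {1..n}) i = mean_var n x i" for x i
    unfolding mean_var_def by (auto intro!: arg_cong2[where f="(/)"] sum.cong)
  have fT: "f i = T f i" if i: "i \<in> {1..n}" for i
  proof (rule LIMSEQ_unique)
    show "(\<lambda>k. X (Suc k) i) \<longlonglongrightarrow> f i" using f by (rule LIMSEQ_Suc)
    have "(\<lambda>k. mean_var n (X k) i) \<longlonglongrightarrow> mean_var n f i"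
      unfolding mean_var_def divide_inverse by (intro tendsto_intros f)
    moreover have cont: "isCont (\<lambda>z. Br a b u z (\<alpha> i)) (mean_var n f i)"
    proof -
      have "Lz-lipschitz_on UNIV (\<lambda>z. Br a b u z (\<alpha> i))"
        by (rule lipschitz_onI) (use lip assms(2) in \<open>auto simp: dist_real_def\<close>)
      then show ?thesis
        using lipschitz_on_continuous_on continuous_on_eq_continuous_at open_UNIV by blast
    qed
    ultimately show "(\<lambda>k. X (Suc k) i) \<longlonglongrightarrow> T f i"
      unfolding X_Suc T_def using i isCont_tendsto_compose[OF cont] by simp
  qed
  have "is_nash a b u \<alpha> n (restrict f {1..n})"
    unfolding is_nash_def
  proof (intro conjI ballI)
    have eq: "f i = Br a b u (mean_var n f i) (\<alpha> i)"
      if "i \<in> {1..n}" for i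
      using fT[OF that] that by (simp add: T_def)
    show "restrict f {1..n} \<in> {1..n} \<rightarrow>\<^sub>E {a..b}"
      using eq Br_in by (intro restrict_PiE[THEN iffD2] Pi_I) metis
    show "restrict f {1..n} i
        = Br a b u (mean_var n (restrict f {1..n}) i) (\<alpha> i)"
      if "i \<in> {1..n}" for i
      unfolding mv using eq[OF that] that by simp
  qed
  moreover have "x = y" if x: "is_nash a b u \<alpha> n x" and y: "is_nash a b u \<alpha> n y" for x y
  proof -
    define d where "d = Max ((\<lambda>i. \<bar>x i - y i\<bar>) ` {1..n})"
    have le: "\<bar>x i - y i\<bar> \<le> d" if "i \<in> {1..n}" for i
      unfolding d_def using that by (intro Max_ge) auto
    have d0: "d \<ge> 0" using le[of 1] n by auto
    have "d \<in> (\<lambda>i. \<bar>x i - y i\<bar>) ` {1..n}"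
      unfolding d_def using n by (intro Max_in) auto
    then obtain i where i: "i \<in> {1..n}" "d = \<bar>x i - y i\<bar>" by blast
    have "x i = T x i" "y i = T y i"
      using x y i(1) by (auto simp: is_nash_def T_def)
    then have "d \<le> Lz * d" using T_lip[OF le d0, where i=i] i(2) by simp
    then have "d = 0" using d0 assms(2,3)
      by (metis mult_le_cancel_right1 not_less order_antisym)
    then have "x j = y j" if "j \<in> {1..n}" for j using le[OF that] by simp
    then show ?thesis using x y unfolding is_nash_def by (metis PiE_ext)
  qed
  ultimately show ?thesis by blast
qed

lemma aem_ex1:
  assumes am: "\<And>z t. \<exists>!x. is_arg_max (\<lambda>x. u x z t) (\<lambda>x. x \<in> {a..b}) x"
    and "0 < Lz" "Lz < 1"
    and lip: "\<And>z z' t. \<bar>Br a b u z t - Br a b u z' t\<bar> \<le> Lz * \<bar>z - z'\<bar>"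
    and "0 < L"
    and lip2: "\<And>z t t'. \<bar>Br a b u z t - Br a b u z t'\<bar> \<le> L * \<bar>t - t'\<bar>"
    and P: "mono P" "continuous_on UNIV P" "(P \<longlongrightarrow> 0) at_bot" "(P \<longlongrightarrow> 1) at_top"
  shows "\<exists>!z. is_aem a b u P z"
proof -
  interpret real_distribution "interval_measure P"
    using P by (intro real_distribution_interval_measure)
      (auto simp: mono_def continuous_on_eq_continuous_within intro: continuous_within_subset)
  have Br_in: "Br a b u z t \<in> {a..b}" for z t
    using am by (rule Br_in_interval)
  have "L-lipschitz_on UNIV (Br a b u z)" for z
    by (rule lipschitz_onI) (use lip2 \<open>0 < L\<close> in \<open>auto simp: dist_real_def\<close>)
  then have "continuous_on UNIV (Br a b u z)" for z
    by (rule lipschitz_on_continuous_on)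
  then have meas: "Br a b u z \<in> borel_measurable (interval_measure P)" for z
    using borel_measurable_continuous_onI by (metis measurable_cong_sets M_is_borel)
  have bd: "\<bar>Br a b u z t\<bar> \<le> \<bar>a\<bar> + \<bar>b\<bar>" for z t
    using Br_in[of z t] by auto
  have int: "integrable (interval_measure P) (Br a b u z)" for z
    by (rule integrable_const_bound[of _ "\<bar>a\<bar> + \<bar>b\<bar>"]) (use bd meas in auto)
  define F where "F z = (LINT t|interval_measure P. Br a b u z t)" for z
  have "\<exists>!z. F z = z"
  proof (rule banach_fix_type[of Lz])
    show "\<forall>z z'. dist (F z) (F z') \<le> Lz * dist z z'"
    proof (intro allI)
      fix z z'
      have "dist (F z) (F z') = norm (LINT t|interval_measure P. Br a b u z t - Br a b u z' t)"
        unfolding F_def dist_norm using int by simp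
      also have "\<dots> \<le> (LINT t|interval_measure P. Lz * \<bar>z - z'\<bar>)"
        using lip int by (intro Bochner_Integration.integral_norm_bound_integral) auto
      also have "\<dots> = Lz * \<bar>z - z'\<bar>" using prob_space by simp
      finally show "dist (F z) (F z') \<le> Lz * dist z z'" by (simp add: dist_real_def)
    qed
  qed (use assms in auto)
  then show ?thesis unfolding is_aem_def F_def by metis
qed

end

theory Submission
  imports Defs "HOL-Real_Asymp.Real_Asymp"
begin

text \<open>
  In a large population every agent sees almost the same aggregate: removing one agent from the
  average \<open>m\<close> of the equilibrium actions shifts it by at most \<open>(b - a) / (n - 1)\<close>
  (\<open>mean_var_near_average\<close>). Hence \<open>m\<close> nearly solves \<open>m = (1/n) \<Sum>\<^sub>i Br(m, \<alpha>\<^sub>i)\<close>, the finite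
  counterpart of the equation that defines the asymptotic equilibrium mean \<open>z\<close>. Both right-hand
  sides are \<open>Lz\<close>-contractions, so \<open>\<bar>m - z\<bar>\<close> is at most \<open>1 / (1 - Lz)\<close> times the sum
  of the leave-one-out error and the discrepancy between the two right-hand sides evaluated at the
  single point \<open>z\<close> (\<open>nash_mean_var_error\<close>).

  That discrepancy is the difference between the integrals of the one function \<open>Br(z, \<cdot>)\<close> with
  respect to the empirical distribution and to \<open>dP\<close>. As \<open>z\<close> does not depend on \<open>n\<close> and \<open>Br(z, \<cdot>)\<close> is
  bounded and continuous, it vanishes in the limit by weak convergence of the empirical
  distributions (\<open>empirical_average_tendsto\<close>).
\<close>

section \<open>Empirical averages of bounded continuous functions\<close>

text \<open>
  Realising the empirical distribution as the law of \<open>\<alpha>\<close> at a uniformly chosen index turns its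
  distribution function into \<^const>\<open>emp_cdf\<close>, so that the hypothesis on the parameters becomes weak
  convergence of measures.
\<close>

lemma empirical_average_tendsto:
  fixes f :: "real \<Rightarrow> real"
  assumes P: "mono P" "continuous_on UNIV P" "(P \<longlongrightarrow> 0) at_bot" "(P \<longlongrightarrow> 1) at_top"
    and emp: "\<And>t. (\<lambda>n. emp_cdf \<alpha> n t) \<longlonglongrightarrow> P t"
    and f: "continuous_on UNIV f" "\<And>t. \<bar>f t\<bar> \<le> B"
  shows "(\<lambda>n. (\<Sum>i=1..n. f (\<alpha> i)) / real n) \<longlonglongrightarrow> (LINT t|interval_measure P. f t)"
proof -
  have P_rc: "continuous (at_right x) P" for x
    using P(2) by (auto simp: continuous_on_eq_continuous_within intro: continuous_within_subset)
  \<comment> \<open>At \<open>n = 0\<close> this is an unspecified probability measure, which the limit does not see; the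
      identities with empirical averages start at \<open>n = 1\<close>.\<close>
  define U where "U n = measure_pmf (pmf_of_set {1..n})" for n :: nat
  define M where "M n = distr (U n) borel \<alpha>" for n
  have \<alpha>_meas: "\<alpha> \<in> borel_measurable (U n)" for n
    by (simp add: U_def)
  have M: "real_distribution (M n)" for n
    using \<alpha>_meas unfolding M_def U_def by (intro prob_space.real_distribution_distr measure_pmf.prob_space_axioms) auto
  have Q: "real_distribution (interval_measure P)"
    using P P_rc by (intro real_distribution_interval_measure) (auto simp: mono_def)
  have cdf_M: "cdf (M n) t = emp_cdf \<alpha> n t" if "n \<ge> 1" for n t
  proof -
    have "cdf (M n) t = measure (U n) {i. \<alpha> i \<le> t}"
      unfolding cdf_def M_def by (subst measure_distr) (auto simp: U_def vimage_def)
    also have "\<dots> = emp_cdf \<alpha> n t"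
      using that unfolding U_def emp_cdf_def
      by (subst measure_pmf_of_set) (auto simp: sum.If_cases of_bool_def)
    finally show ?thesis .
  qed
  have cdf_Q: "cdf (interval_measure P) = P"
    using P P_rc by (intro cdf_interval_measure) (auto simp: mono_def)
  have "weak_conv_m M (interval_measure P)"
    unfolding weak_conv_m_def weak_conv_def cdf_Q
  proof (intro allI impI)
    fix t
    have "\<forall>\<^sub>F n in sequentially. emp_cdf \<alpha> n t = cdf (M n) t"
      using eventually_ge_at_top[of 1] by eventually_elim (simp add: cdf_M)
    then show "(\<lambda>n. cdf (M n) t) \<longlonglongrightarrow> P t"
      using emp[of t] by (rule Lim_transform_eventually[rotated])
  qed
  then have "(\<lambda>n. LINT t|M n. f t) \<longlonglongrightarrow> (LINT t|interval_measure P. f t)"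
    using M Q f
    by (intro weak_conv_imp_integral_bdd_continuous_conv[where B=B])
      (auto simp: continuous_on_eq_continuous_at)
  moreover have "\<forall>\<^sub>F n in sequentially. (LINT t|M n. f t) = (\<Sum>i=1..n. f (\<alpha> i)) / real n"
    using eventually_ge_at_top[of 1]
  proof eventually_elim
    case (elim n)
    have "(LINT t|M n. f t) = (LINT i|U n. f (\<alpha> i))"
      unfolding M_def using \<alpha>_meas borel_measurable_continuous_onI[OF f(1)]
      by (intro integral_distr)
    also have "\<dots> = (\<Sum>i=1..n. f (\<alpha> i)) / real n"
      using elim unfolding U_def by (subst integral_pmf_of_set) auto
    finally show ?case .
  qed
  ultimately show ?thesis
    by (rule Lim_transform_eventually)
qed

section \<open>The error of a finite equilibrium\<close>

lemma average_in_interval: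
  fixes x :: "nat \<Rightarrow> real"
  assumes "n \<ge> 1" "x \<in> {1..n} \<rightarrow> {a..b}"
  shows "(\<Sum>j=1..n. x j) / real n \<in> {a..b}"
proof -
  have "real n * a \<le> (\<Sum>j=1..n. x j)" "(\<Sum>j=1..n. x j) \<le> real n * b"
    using sum_bounded_below[of "{1..n}" a x] sum_bounded_above[of "{1..n}" x b] assms(2)
    by (force simp: Pi_iff)+
  then show ?thesis
    using assms(1) by (simp add: field_simps)
qed

text \<open>
  With the average \<open>m\<close>, the mean variable exceeds \<open>m\<close> by exactly \<open>(m - x\<^sub>i) / (n - 1)\<close>, and \<open>m\<close> and
  \<open>x\<^sub>i\<close> lie in the same interval.
\<close>

lemma mean_var_near_average:
  assumes n: "n \<ge> 2" and i: "i \<in> {1..n}" and x: "x \<in> {1..n} \<rightarrow> {a..b}"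
  shows "\<bar>mean_var n x i - (\<Sum>j=1..n. x j) / real n\<bar> \<le> (b - a) / (real n - 1)"
proof -
  define m where "m = (\<Sum>j=1..n. x j) / real n"
  have sum_eq: "(\<Sum>j=1..n. x j) = real n * m"
    using n by (simp add: m_def)
  have "(\<Sum>j\<in>{1..n} - {i}. x j) = real n * m - x i"
    using i by (simp add: sum_diff1 sum_eq del: One_nat_def)
  then have "mean_var n x i - m = (m - x i) / (real n - 1)"
    using n by (simp add: mean_var_def field_simps)
  moreover have "m \<in> {a..b}"
    unfolding m_def using n x by (intro average_in_interval) auto
  moreover have "x i \<in> {a..b}"
    using x i by blast
  ultimately show ?thesis
    unfolding m_def[symmetric] using n
    by (auto simp: abs_divide intro!: divide_right_mono)
qed

text \<open>
  Let \<open>m\<close> be the average equilibrium action and \<open>d\<close> the leave-one-out error. Replacing every mean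
  variable by \<open>z\<close> moves the average response by at most \<open>Lz (\<bar>m - z\<bar> + d)\<close>; absorbing
  \<open>Lz \<bar>m - z\<bar>\<close> on the left produces the factor \<open>1 / (1 - Lz)\<close>. The point \<open>z\<close> is arbitrary: the
  bound compares the equilibrium with any approximate solution of the averaged best-response
  equation.
\<close>

lemma nash_mean_var_error:
  assumes Lz: "0 < Lz" "Lz < 1"
    and lip: "\<And>z z' t. \<bar>Br a b u z t - Br a b u z' t\<bar> \<le> Lz * \<bar>z - z'\<bar>"
    and n: "n \<ge> 2" and x: "is_nash a b u \<alpha> n x" and i: "i \<in> {1..n}"
  shows "\<bar>mean_var n x i - z\<bar>
    \<le> ((b - a) / (real n - 1) + \<bar>(\<Sum>j=1..n. Br a b u z (\<alpha> j)) / real n - z\<bar>) / (1 - Lz)"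
proof -
  define m where "m = (\<Sum>j=1..n. x j) / real n"
  define d where "d = (b - a) / (real n - 1)"
  define e where "e = \<bar>(\<Sum>j=1..n. Br a b u z (\<alpha> j)) / real n - z\<bar>"
  have x_in: "x \<in> {1..n} \<rightarrow> {a..b}"
    and x_br: "\<And>j. j \<in> {1..n} \<Longrightarrow> x j = Br a b u (mean_var n x j) (\<alpha> j)"
    using x by (auto simp: is_nash_def PiE_def)
  have near: "\<bar>mean_var n x j - m\<bar> \<le> d" if "j \<in> {1..n}" for j
    using mean_var_near_average[OF n that x_in] by (simp add: m_def d_def)
  have resp: "\<bar>x j - Br a b u z (\<alpha> j)\<bar> \<le> Lz * (\<bar>m - z\<bar> + d)" if j: "j \<in> {1..n}" for j
  proof -
    have "\<bar>x j - Br a b u z (\<alpha> j)\<bar> \<le> Lz * \<bar>mean_var n x j - z\<bar>"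
      using lip x_br[OF j] by metis
    also have "\<dots> \<le> Lz * (\<bar>m - z\<bar> + d)"
      using near[OF j] Lz by (intro mult_left_mono) auto
    finally show ?thesis .
  qed
  have "\<bar>\<Sum>j=1..n. x j - Br a b u z (\<alpha> j)\<bar> \<le> (\<Sum>j=1..n. \<bar>x j - Br a b u z (\<alpha> j)\<bar>)"
    by (rule sum_abs)
  also have "\<dots> \<le> real n * (Lz * (\<bar>m - z\<bar> + d))"
    using sum_bounded_above[of "{1..n}", OF resp] by simp
  finally have "\<bar>\<Sum>j=1..n. x j - Br a b u z (\<alpha> j)\<bar> / real n \<le> Lz * (\<bar>m - z\<bar> + d)"
    using n by (simp add: field_simps)
  moreover have "m - (\<Sum>j=1..n. Br a b u z (\<alpha> j)) / real n
      = (\<Sum>j=1..n. x j - Br a b u z (\<alpha> j)) / real n"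
    by (simp add: m_def sum_subtractf diff_divide_distrib)
  ultimately have "\<bar>m - (\<Sum>j=1..n. Br a b u z (\<alpha> j)) / real n\<bar> \<le> Lz * (\<bar>m - z\<bar> + d)"
    by (simp only: abs_divide abs_of_nat)
  then have "\<bar>m - z\<bar> \<le> Lz * (\<bar>m - z\<bar> + d) + e"
    unfolding e_def by linarith
  \<comment> \<open>Trading the average \<open>m\<close> for the mean variable costs another \<open>d\<close>, which the contraction factor
      turns into the single \<open>d\<close> of the bound: \<open>Lz d + (1 - Lz) d = d\<close>.\<close>
  moreover have "(1 - Lz) * \<bar>mean_var n x i - z\<bar> \<le> (1 - Lz) * (\<bar>m - z\<bar> + d)"
    using near[OF i] Lz by (intro mult_left_mono) auto
  ultimately have "(1 - Lz) * \<bar>mean_var n x i - z\<bar> \<le> d + e"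
    by (simp add: algebra_simps)
  then show ?thesis
    using Lz unfolding d_def[symmetric] e_def[symmetric] by (simp add: pos_le_divide_eq mult.commute)
qed

section \<open>Convergence to the asymptotic equilibrium mean\<close>

theorem theorem1:
  fixes a b Lz L :: real
    and u :: "real \<Rightarrow> real \<Rightarrow> real \<Rightarrow> real"
    and \<alpha> :: "nat \<Rightarrow> real"
    and P :: "real \<Rightarrow> real"
  assumes "a \<le> b"
    and "\<And>z t. \<exists>!x. is_arg_max (\<lambda>x. u x z t) (\<lambda>x. x \<in> {a..b}) x"
    and "0 < Lz" and "Lz < 1"
    and "\<And>z z' t. \<bar>Br a b u z t - Br a b u z' t\<bar> \<le> Lz * \<bar>z - z'\<bar>"
    and "0 < L"
    and "\<And>z t t'. \<bar>Br a b u z t - Br a b u z t'\<bar> \<le> L * \<bar>t - t'\<bar>"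
    and "mono P" and "continuous_on UNIV P"
    and "(P \<longlongrightarrow> 0) at_bot" and "(P \<longlongrightarrow> 1) at_top"
    and "\<And>t. (\<lambda>n. emp_cdf \<alpha> n t) \<longlonglongrightarrow> P t"
  shows "(\<lambda>n. SUP i\<in>{1..n}. \<bar>mean_var n (nash a b u \<alpha> n) i - aem a b u P\<bar>) \<longlonglongrightarrow> 0"
proof -
  define z where "z = aem a b u P"
  define err where "err n = ((b - a) / (real n - 1)
    + \<bar>(\<Sum>j=1..n. Br a b u z (\<alpha> j)) / real n - z\<bar>) / (1 - Lz)" for n
  have "is_aem a b u P z"
    unfolding z_def aem_def using aem_ex1[OF assms(2-11)] by (rule theI')
  then have z_fix: "(LINT t|interval_measure P. Br a b u z t) = z"
    by (simp add: is_aem_def)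
  have "(\<lambda>n. (\<Sum>j=1..n. Br a b u z (\<alpha> j)) / real n) \<longlonglongrightarrow> (LINT t|interval_measure P. Br a b u z t)"
  proof (rule empirical_average_tendsto)
    have "L-lipschitz_on UNIV (Br a b u z)"
      by (rule lipschitz_onI) (use assms(6,7) in \<open>auto simp: dist_real_def\<close>)
    then show "continuous_on UNIV (Br a b u z)"
      by (rule lipschitz_on_continuous_on)
    have "Br a b u z t \<in> {a..b}" for t
      using assms(2) by (rule Br_in_interval)
    then show "\<bar>Br a b u z t\<bar> \<le> \<bar>a\<bar> + \<bar>b\<bar>" for t
      by (smt (verit) atLeastAtMost_iff)
  qed (use assms in auto)
  then have avg: "(\<lambda>n. (\<Sum>j=1..n. Br a b u z (\<alpha> j)) / real n) \<longlonglongrightarrow> z"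
    by (simp only: z_fix)
  have "(\<lambda>n. (b - a) / (real n - 1)) \<longlonglongrightarrow> 0"
    by real_asymp
  then have "err \<longlonglongrightarrow> (0 + \<bar>z - z\<bar>) / (1 - Lz)"
    unfolding err_def using assms(4) by (intro tendsto_intros avg) auto
  then have err_lim: "err \<longlonglongrightarrow> 0"
    by simp
  have bound: "\<bar>mean_var n (nash a b u \<alpha> n) i - z\<bar> \<le> err n" if "n \<ge> 2" "i \<in> {1..n}" for n i
  proof -
    have "is_nash a b u \<alpha> n (nash a b u \<alpha> n)"
      unfolding nash_def using nash_ex1[OF assms(2-5) that(1)] by (rule theI')
    then show ?thesis
      unfolding err_def using nash_mean_var_error[OF assms(3-5) that(1) _ that(2)] by blast
  qed
  show ?thesis
    unfolding z_def[symmetric]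
  proof (rule tendsto_sandwich[OF _ _ tendsto_const err_lim])
    show "\<forall>\<^sub>F n in sequentially. 0 \<le> (SUP i\<in>{1..n}. \<bar>mean_var n (nash a b u \<alpha> n) i - z\<bar>)"
      using eventually_ge_at_top[of 1]
      by eventually_elim (rule cSUP_upper2[of _ _ 1], auto)
    show "\<forall>\<^sub>F n in sequentially. (SUP i\<in>{1..n}. \<bar>mean_var n (nash a b u \<alpha> n) i - z\<bar>) \<le> err n"
      using eventually_ge_at_top[of 2]
      by eventually_elim (rule cSUP_least, use bound in auto)
  qed
qed

end
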